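(* Let $m\ge 1$ and let $a,b_1,\dots,b_m$ be positive integers with $\gcd(a,b_1,\dots,b_m)=1$, where for each $j\in\{1,\dots,m\}$ we write $b_j=ak_j+\ell_j$ with $k_j\in\mathbb{N}$ and $\ell_j\in\{1,\dots,a-1\}$ (so in particular $a\nmid b_j$). Then the set of points $(x_1,\dots,x_{a-1})\in\mathbb{R}^{a-1}$ satisfying the following inequalities is a polytope (in particular it is bounded), and there is a bijection between the set of $(a,b_1,\dots,b_m)$-core partitions and the set of integer points of this polytope: \[ \begin{aligned} x_{\ell_j} &\le k_j && \text{for all } j\in\{1,\dots,m\},\\ x_{i+\ell_j} &\le k_j+x_i && \text{for all } j\in\{1,\dots,m\},\ i\in\{1,\dots,a-1\} \text{ with } i+\ell_j<a,\\ x_{i+\ell_j-a} &\le k_j+x_i+1 && \text{for all } j\in\{1,\dots,m\},\ i\in\{1,\dots,a-1\} \text{ with } i+\ell_j>a,\\ x_i &\ge 0 && \text{for all } i\in\{1,\dots,a-1\}. \end{aligned} \]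
   Context: $\mathbb{N}=\{0,1,2,\dots\}$. A partition is a finite (possibly empty) weakly decreasing sequence of positive integers, represented by its Young diagram. The hook length of a box is the number of boxes directly to its right plus the number directly below it plus one. A partition is an $a$-core if none of its hook lengths is divisible by $a$, and an $(a,b_1,\dots,b_m)$-core if it is an $a$-core and a $b_j$-core for every $j$. *)

theory Defs
  imports "HOL-Analysis.Analysis"
begin

definition is_partition :: "nat list \<Rightarrow> bool" where
  "is_partition p \<longleftrightarrow> sorted_wrt (\<ge>) p \<and> (\<forall>c\<in>set p. 0 < c)"

text \<open>Boxes are pairs (row, column), both counted from 0, with rows going downwards.\<close>

definition young_diagram :: "nat list \<Rightarrow> (nat \<times> nat) set" where
  "young_diagram p = {(r, c). r < length p \<and> c < p ! r}"

definition hook_length :: "nat list \<Rightarrow> nat \<times> nat \<Rightarrow> nat" where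
  "hook_length p = (\<lambda>(r, c).
     card {c'. c < c' \<and> (r, c') \<in> young_diagram p}
   + card {r'. r < r' \<and> (r', c) \<in> young_diagram p} + 1)"

definition is_core :: "nat \<Rightarrow> nat list \<Rightarrow> bool" where
  "is_core a p \<longleftrightarrow> (\<forall>s\<in>young_diagram p. \<not> a dvd hook_length p s)"

definition simultaneous_cores :: "nat \<Rightarrow> nat \<Rightarrow> (nat \<Rightarrow> nat) \<Rightarrow> nat list set" where
  "simultaneous_cores a m b =
     {p. is_partition p \<and> is_core a p \<and> (\<forall>j\<in>{1..m}. is_core (b j) p)}"

text \<open>
  The space of (a-1)-tuples of reals is \<^typ>\<open>real ^ 'n\<close>, where \<open>idx\<close> is meant to be a bijection
  from \<open>{1..a-1}\<close> onto the index type \<open>'n\<close>; thus \<open>x $ idx i\<close> is the coordinate with number \<open>i\<close>.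
\<close>

definition core_inequalities ::
  "(nat \<Rightarrow> 'n::finite) \<Rightarrow> nat \<Rightarrow> nat \<Rightarrow> (nat \<Rightarrow> nat) \<Rightarrow> (nat \<Rightarrow> nat) \<Rightarrow> (real ^ 'n) set" where
  "core_inequalities idx a m k l = {x.
     (\<forall>j\<in>{1..m}. x $ idx (l j) \<le> real (k j)) \<and>
     (\<forall>j\<in>{1..m}. \<forall>i\<in>{1..a-1}. i + l j < a \<longrightarrow>
        x $ idx (i + l j) \<le> real (k j) + x $ idx i) \<and>
     (\<forall>j\<in>{1..m}. \<forall>i\<in>{1..a-1}. i + l j > a \<longrightarrow>
        x $ idx (i + l j - a) \<le> real (k j) + x $ idx i + 1) \<and>
     (\<forall>i\<in>{1..a-1}. 0 \<le> x $ idx i)}"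

definition integer_points :: "(real ^ 'n::finite) set \<Rightarrow> (real ^ 'n) set" where
  "integer_points S = {x\<in>S. \<forall>c. x $ c \<in> \<int>}"

end

theory Submission imports Defs begin

text \<open>A partition is determined by its beta set \<open>B\<close>, the set of hook lengths in its first column, and
  it is a \<open>d\<close>-core iff the complement of \<open>B\<close> in the natural numbers is closed under adding \<open>d\<close>. For
  an \<open>a\<close>-core the complement is described by its least element \<open>a x\<^sub>i + i\<close> in every residue class
  modulo \<open>a\<close>, and closure under adding \<open>b\<^sub>j\<close> becomes the stated inequalities. They bound
  the coordinates because, by the gcd condition, every residue is reached from \<open>0\<close> by adding
  the \<open>b\<^sub>j\<close>, each step increasing the bound by a constant.\<close>

section \<open>Beta sets of partitions and the enumeration of their complements\<close>

fun beta_set :: "nat list \<Rightarrow> nat set" where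
  "beta_set [] = {}"
| "beta_set (c # p) = insert (c + length p) (beta_set p)"

text \<open>The label of the horizontal step of column \<open>c\<close> on the boundary path, read
  from the bottom left with steps numbered from 0: \<open>c\<close> horizontal steps and the rows of
  length at most \<open>c\<close> precede it. The beta set labels the vertical steps.\<close>

definition gap :: "nat list \<Rightarrow> nat \<Rightarrow> nat" where
  "gap p c = c + length (filter (\<lambda>x. x \<le> c) p)"

lemma is_partition_Nil [simp]: "is_partition []"
  by (simp add: is_partition_def)

lemma is_partition_Cons:
  "is_partition (c # p) \<longleftrightarrow> 0 < c \<and> (\<forall>x\<in>set p. x \<le> c) \<and> is_partition p"
  by (auto simp: is_partition_def)

lemma finite_beta_set [simp]: "finite (beta_set p)"
  by (induction p) auto

text \<open>Makes the number contributed by a new longest row the strict maximum, which the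
  inductions over rows rely on.\<close>

lemma beta_set_less:
  assumes "\<forall>x\<in>set p. x \<le> c" "z \<in> beta_set p"
  shows "z < c + length p"
  using assms by (induction p) force+

lemma card_beta_set: "is_partition p \<Longrightarrow> card (beta_set p) = length p"
proof (induction p)
  case (Cons c p)
  then have "c + length p \<notin> beta_set p"
    using beta_set_less[of p c "c + length p"] by (auto simp: is_partition_Cons)
  with Cons show ?case
    by (simp add: is_partition_Cons)
qed simp

lemma zero_notin_beta_set: "is_partition p \<Longrightarrow> 0 \<notin> beta_set p"
  by (induction p) (auto simp: is_partition_Cons)

lemma strict_mono_gap: "strict_mono (gap p)"
proof (rule strict_monoI)
  fix c d :: nat assume "c < d"
  then have "length (filter (\<lambda>x. x \<le> c) p) \<le> length (filter (\<lambda>x. x \<le> d) p)"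
    by (induction p) auto
  with \<open>c < d\<close> show "gap p c < gap p d"
    by (simp add: gap_def)
qed

lemma gap_ge:
  assumes "\<forall>x\<in>set p. x \<le> c"
  shows "gap p c = c + length p"
  using assms by (simp add: gap_def)

text \<open>Putting a longest row \<open>c\<close> on top moves exactly one number,
  \<open>gap p c = c + length p\<close>, from the complement into the beta set.\<close>

lemma range_gap: "is_partition p \<Longrightarrow> range (gap p) = - beta_set p"
proof (induction p)
  case Nil
  show ?case by (auto simp: gap_def)
next
  case (Cons c p)
  then have le: "\<forall>x\<in>set p. x \<le> c" and IH: "range (gap p) = - beta_set p"
    by (auto simp: is_partition_Cons)
  have below: "gap (c # p) d = gap p d" if "d < c" for d
    using that by (simp add: gap_def)
  \<comment> \<open>From column \<open>c\<close> on, all rows of \<open>p\<close> are counted and so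
    is the new one; the enumeration therefore skips index \<open>c\<close>.\<close>
  have above: "gap (c # p) d = gap p (Suc d)" if "c \<le> d" for d
    using that le by (simp add: gap_def filter_True order_trans[of _ c] le_SucI)
  have at: "gap p c = c + length p"
    using le by (rule gap_ge)
  have "range (gap (c # p)) = gap p ` (UNIV - {c})"
  proof (intro equalityI subsetI)
    fix z assume "z \<in> range (gap (c # p))"
    then obtain d where "z = gap (c # p) d" by blast
    then show "z \<in> gap p ` (UNIV - {c})"
      using below[of d] above[of d] by (cases "d < c") auto
  next
    fix z assume "z \<in> gap p ` (UNIV - {c})"
    then obtain d where d: "z = gap p d" "d \<noteq> c" by blast
    show "z \<in> range (gap (c # p))"
    proof (cases "d < c")
      case True
      with d below have "z = gap (c # p) d" by simp
      then show ?thesis by (rule range_eqI)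
    next
      case False
      with d(2) have "c \<le> d - 1" "Suc (d - 1) = d" by auto
      with d above[of "d - 1"] have "z = gap (c # p) (d - 1)" by simp
      then show ?thesis by (rule range_eqI)
    qed
  qed
  also have "\<dots> = range (gap p) - {gap p c}"
    using strict_mono_imp_inj_on[OF strict_mono_gap[of p]] by (auto simp: inj_on_def)
  finally show ?case
    using IH at by auto
qed

section \<open>Hook lengths and the core condition in terms of beta sets\<close>

lemma hook_length_Cons_Suc: "hook_length (c # p) (Suc r, d) = hook_length p (r, d)"
proof -
  have "(r', d) \<in> young_diagram (c # p) \<longleftrightarrow> (\<exists>s. r' = Suc s \<and> (s, d) \<in> young_diagram p)" if "r' \<noteq> 0" for r'
    using that by (cases r') (auto simp: young_diagram_def)
  then have "{r'. Suc r < r' \<and> (r', d) \<in> young_diagram (c # p)}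
      = Suc ` {r'. r < r' \<and> (r', d) \<in> young_diagram p}"
    by (auto simp: image_iff)
  then show ?thesis
    by (simp add: hook_length_def young_diagram_def card_image)
qed

text \<open>The arm is \<open>c - d - 1\<close>, and the leg is \<open>length p\<close> minus the
  number of rows of length at most \<open>d\<close>, the very number that enters
  \<open>gap p d\<close>.\<close>

lemma hook_length_Cons_0:
  assumes "d < c"
  shows "hook_length (c # p) (0, d) = c + length p - gap p d"
proof -
  have "{r'. 0 < r' \<and> (r', d) \<in> young_diagram (c # p)} = Suc ` {r'. r' < length p \<and> d < p ! r'}"
    by (auto simp: young_diagram_def image_iff gr0_conv_Suc)
  then have leg: "card {r'. 0 < r' \<and> (r', d) \<in> young_diagram (c # p)}
      = length (filter (\<lambda>x. d < x) p)"
    by (simp add: card_image length_filter_conv_card)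
  have "{c'. d < c' \<and> (0, c') \<in> young_diagram (c # p)} = {d<..<c}"
    by (auto simp: young_diagram_def)
  then have arm: "card {c'. d < c' \<and> (0, c') \<in> young_diagram (c # p)} = c - Suc d"
    by simp
  have "length (filter (\<lambda>x. x \<le> d) p) + length (filter (\<lambda>x. d < x) p) = length p"
    using sum_length_filter_compl[of "\<lambda>x. x \<le> d" p] by (simp add: not_le)
  with assms arm leg show ?thesis
    by (simp add: hook_length_def gap_def)
qed

lemma is_core_Cons:
  "is_core a (c # p) \<longleftrightarrow> is_core a p \<and> (\<forall>d<c. \<not> a dvd c + length p - gap p d)"
proof -
  have "young_diagram (c # p)
      = (\<lambda>d. (0, d)) ` {..<c} \<union> (\<lambda>(r, d). (Suc r, d)) ` young_diagram p"
    by (auto simp: young_diagram_def image_iff less_Suc_eq_0_disj)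
  then show ?thesis
    by (auto simp: is_core_def ball_Un hook_length_Cons_Suc hook_length_Cons_0)
qed

text \<open>The hook lengths are the differences \<open>\<beta> - z\<close> with \<open>\<beta>\<close> in the beta set and \<open>z\<close> a smaller
  number outside it: the rows correspond to the \<open>\<beta>\<close>, and column \<open>d\<close> to \<open>z = gap p d\<close>.\<close>

lemma is_core_iff_beta_set_diff:
  assumes "is_partition p"
  shows "is_core a p \<longleftrightarrow> (\<forall>y\<in>beta_set p. \<forall>z. z \<notin> beta_set p \<longrightarrow> z < y \<longrightarrow> \<not> a dvd y - z)"
  using assms
proof (induction p)
  case Nil
  show ?case by (simp add: is_core_def young_diagram_def)
next
  case (Cons c p)
  then have le: "\<forall>x\<in>set p. x \<le> c" and p: "is_partition p"
    by (auto simp: is_partition_Cons)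
  let ?M = "c + length p"
  \<comment> \<open>As \<open>gap p\<close> is increasing with \<open>gap p c = ?M\<close>, the
    columns \<open>d < c\<close> run through exactly the nonmembers below \<open>?M\<close>.\<close>
  have *: "(\<forall>d<c. \<not> a dvd ?M - gap p d) \<longleftrightarrow> (\<forall>z. z \<notin> beta_set p \<longrightarrow> z < ?M \<longrightarrow> \<not> a dvd ?M - z)"
  proof -
    have "d < c \<longleftrightarrow> gap p d < ?M" for d
      using strict_mono_less[OF strict_mono_gap[of p], of d c] gap_ge[OF le] by simp
    moreover have "z \<notin> beta_set p \<longleftrightarrow> (\<exists>d. z = gap p d)" for z
      using range_gap[OF p] by blast
    ultimately show ?thesis by auto
  qed
  have less: "y < ?M" if "y \<in> beta_set p" for y
    using beta_set_less[OF le that] .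
  have "is_core a (c # p) \<longleftrightarrow>
      (\<forall>y\<in>beta_set p. \<forall>z. z \<notin> beta_set p \<longrightarrow> z < y \<longrightarrow> \<not> a dvd y - z) \<and>
      (\<forall>z. z \<notin> beta_set p \<longrightarrow> z < ?M \<longrightarrow> \<not> a dvd ?M - z)"
    by (simp add: is_core_Cons * Cons.IH[OF p])
  \<comment> \<open>No \<open>y\<close> in the enlarged set exceeds \<open>?M\<close>, so excluding
    \<open>z = ?M\<close> loses no pair.\<close>
  also have "\<dots> \<longleftrightarrow> (\<forall>y\<in>insert ?M (beta_set p). \<forall>z.
      z \<notin> insert ?M (beta_set p) \<longrightarrow> z < y \<longrightarrow> \<not> a dvd y - z)"
    using less by (metis insert_iff less_irrefl less_asym)
  finally show ?case by simp
qed

text \<open>Closure is the case of difference \<open>a\<close>; iterating it rules out every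
  positive multiple of \<open>a\<close> as a hook length.\<close>

lemma is_core_iff:
  assumes "is_partition p" "0 < a"
  shows "is_core a p \<longleftrightarrow> (\<forall>z. z \<notin> beta_set p \<longrightarrow> z + a \<notin> beta_set p)"
proof
  assume "is_core a p"
  then show "\<forall>z. z \<notin> beta_set p \<longrightarrow> z + a \<notin> beta_set p"
    using assms by (fastforce simp: is_core_iff_beta_set_diff)
next
  assume closed: "\<forall>z. z \<notin> beta_set p \<longrightarrow> z + a \<notin> beta_set p"
  have multiple: "z + a * q \<notin> beta_set p" if "z \<notin> beta_set p" for z q
    by (induction q) (use that closed in \<open>auto simp: algebra_simps dest!: spec[of _ "_ + _"]\<close>)
  show "is_core a p"
    unfolding is_core_iff_beta_set_diff[OF assms(1)]
  proof (intro ballI allI impI notI)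
    fix y z assume "y \<in> beta_set p" "z \<notin> beta_set p" "z < y" "a dvd y - z"
    then obtain q where "y = z + a * q"
      by (metis dvdE le_add_diff_inverse less_imp_le)
    with multiple \<open>z \<notin> beta_set p\<close> \<open>y \<in> beta_set p\<close> show False by blast
  qed
qed

section \<open>Partitions as finite sets of positive integers\<close>

text \<open>The cardinality of the beta set gives the length, and its maximum then gives the first
  row; removing the maximum leaves the beta set of the other rows.\<close>

lemma beta_set_inject:
  assumes "is_partition p" "is_partition q" "beta_set p = beta_set q"
  shows "p = q"
  using assms
proof (induction p arbitrary: q)
  case Nil
  then show ?case by (cases q) auto
next
  case (Cons c p)
  then obtain d q' where q: "q = d # q'"
    by (cases q) auto
  from Cons.prems have len: "length p = length q'"
    using card_beta_set[of "c # p"] card_beta_set[of q] q by simp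
  have p: "is_partition p" "\<forall>x\<in>set p. x \<le> c" and q': "is_partition q'" "\<forall>x\<in>set q'. x \<le> d"
    using Cons.prems q by (auto simp: is_partition_Cons)
  have notin: "c + length p \<notin> beta_set p" "d + length q' \<notin> beta_set q'"
    using beta_set_less[OF p(2)] beta_set_less[OF q'(2)] by blast+
  have eq: "insert (c + length p) (beta_set p) = insert (d + length q') (beta_set q')"
    using Cons.prems(3) q by simp
  have "c = d"
  proof (rule antisym; rule ccontr)
    assume "\<not> c \<le> d"
    with eq len have "c + length p \<in> beta_set q'" by auto
    with beta_set_less[OF q'(2)] len \<open>\<not> c \<le> d\<close> show False by fastforce
  next
    assume "\<not> d \<le> c"
    with eq[symmetric] len have "d + length q' \<in> beta_set p" by auto
    with beta_set_less[OF p(2)] len \<open>\<not> d \<le> c\<close> show False by fastforce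
  qed
  with eq notin len have "beta_set p = beta_set q'"
    by (metis insert_ident)
  with Cons.IH[OF p(1) q'(1)] \<open>c = d\<close> q show ?case by simp
qed

lemma ex_partition_beta_set:
  assumes "finite B" "0 \<notin> B"
  shows "\<exists>p. is_partition p \<and> beta_set p = B"
  using assms
proof (induction B rule: finite_linorder_max_induct)
  case empty
  show ?case by (intro exI[of _ "[]"]) simp
next
  case (insert M B)
  then obtain p where p: "is_partition p" "beta_set p = B" by auto
  define c where "c = M - length p"
  \<comment> \<open>The first row \<open>d\<close> of \<open>p\<close> contributes
    \<open>d + length q < M\<close>, hence \<open>d \<le> M - length p\<close>: the new row is long
    enough. If \<open>p\<close> is empty, \<open>0 < M\<close> suffices.\<close>
  have "length p < M \<and> (\<forall>x\<in>set p. x \<le> c)"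
  proof (cases p)
    case Nil
    with insert.prems show ?thesis by simp
  next
    case (Cons d q)
    with p insert.hyps have "d + length q < M" by auto
    moreover have "0 < d" "\<forall>x\<in>set q. x \<le> d"
      using p(1) Cons by (auto simp: is_partition_Cons)
    ultimately show ?thesis
      using Cons by (auto simp: c_def)
  qed
  with p show ?case
    by (intro exI[of _ "c # p"]) (auto simp: is_partition_Cons c_def)
qed

text \<open>The target no longer mentions partitions; the integer points will be matched with the
  same family of sets.\<close>

lemma bij_betw_beta_set:
  assumes "0 < a" "\<forall>j\<in>{1..m}. 0 < b j"
  shows "bij_betw beta_set (simultaneous_cores a m b)
    {B. finite B \<and> 0 \<notin> B \<and> (\<forall>z. z \<notin> B \<longrightarrow> z + a \<notin> B)
      \<and> (\<forall>j\<in>{1..m}. \<forall>z. z \<notin> B \<longrightarrow> z + b j \<notin> B)}" (is "bij_betw _ _ ?T")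
proof (rule bij_betw_imageI)
  show "inj_on beta_set (simultaneous_cores a m b)"
    unfolding simultaneous_cores_def by (intro inj_onI beta_set_inject) simp_all
  have core: "p \<in> simultaneous_cores a m b \<longleftrightarrow> beta_set p \<in> ?T" if "is_partition p" for p
  proof -
    have "(\<forall>j\<in>{1..m}. is_core (b j) p) \<longleftrightarrow>
        (\<forall>j\<in>{1..m}. \<forall>z. z \<notin> beta_set p \<longrightarrow> z + b j \<notin> beta_set p)"
      by (intro ball_cong refl is_core_iff that) (use assms(2) in blast)
    then show ?thesis
      by (simp only: simultaneous_cores_def mem_Collect_eq is_core_iff[OF that assms(1)]
          zero_notin_beta_set[OF that] finite_beta_set that simp_thms)
  qed
  show "beta_set ` simultaneous_cores a m b = ?T"
  proof (intro equalityI subsetI)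
    fix B assume "B \<in> beta_set ` simultaneous_cores a m b"
    then obtain p where p: "p \<in> simultaneous_cores a m b" "B = beta_set p" by (rule imageE)
    then have "is_partition p" by (simp add: simultaneous_cores_def)
    from iffD1[OF core[OF this] p(1)] p(2) show "B \<in> ?T" by (simp only:)
  next
    fix B assume B: "B \<in> ?T"
    then have "finite B" "0 \<notin> B" by (simp_all only: mem_Collect_eq not_False_eq_True)
    then obtain p where p: "is_partition p" "beta_set p = B"
      using ex_partition_beta_set by blast
    have "p \<in> simultaneous_cores a m b"
      unfolding core[OF p(1)] p(2) by (rule B)
    with p(2) show "B \<in> beta_set ` simultaneous_cores a m b" by blast
  qed
qed

section \<open>The inequalities as a finite intersection of half-spaces\<close>

text \<open>The coordinates are completed by \<open>x\<^sub>0 = 0\<close> so that all inequalities take the uniform shape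
  of \<open>core_inequalities_iff\<close>.\<close>

definition coord :: "(nat \<Rightarrow> 'n::finite) \<Rightarrow> real ^ 'n \<Rightarrow> nat \<Rightarrow> real" where
  "coord idx x i = (if i = 0 then 0 else x $ idx i)"

text \<open>The quotient \<open>(i + l j) div a\<close> is a carry, 0 or 1. The first family of
  inequalities is \<open>i = 0\<close>, the second has no carry, the third has carry 1.\<close>

lemma core_inequalities_iff:
  assumes "0 < a" "\<forall>j\<in>{1..m}. l j \<in> {1..a-1}"
  shows "x \<in> core_inequalities idx a m k l \<longleftrightarrow>
    (\<forall>i<a. 0 \<le> coord idx x i) \<and>
    (\<forall>j\<in>{1..m}. \<forall>i<a. coord idx x ((i + l j) mod a)
        \<le> real (k j + (i + l j) div a) + coord idx x i)" (is "?L \<longleftrightarrow> ?N \<and> ?R")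
proof
  assume L: ?L
  have N: ?N
    using L by (auto simp: core_inequalities_def coord_def)
  moreover have ?R
  proof (intro ballI allI impI)
    fix j i assume j: "j \<in> {1..m}" and i: "i < a"
    then have l: "1 \<le> l j" "l j < a" using assms by fastforce+
    consider "i = 0" | "0 < i" "i + l j < a" | "i + l j = a" | "0 < i" "i + l j > a"
      by linarith
    then show "coord idx x ((i + l j) mod a) \<le> real (k j + (i + l j) div a) + coord idx x i"
    proof cases
      case 1
      with L j l show ?thesis by (auto simp: core_inequalities_def coord_def)
    next
      case 2
      with L j l i show ?thesis by (auto simp: core_inequalities_def coord_def)
    next
      \<comment> \<open>The target coordinate is \<open>x\<^sub>0 = 0\<close>, so this instance,
        absent from the original list, follows from nonnegativity.\<close>
      case 3
      with N i show ?thesis by (simp add: coord_def)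
    next
      case 4
      then have "(i + l j) mod a = i + l j - a" "(i + l j) div a = 1"
        using i l by (auto simp: mod_if div_if)
      moreover have "x $ idx (i + l j - a) \<le> real (k j) + x $ idx i + 1"
        using L j i 4 by (simp add: core_inequalities_def)
      ultimately show ?thesis using 4 by (simp add: coord_def)
    qed
  qed
  ultimately show "?N \<and> ?R" ..
next
  assume R: "?N \<and> ?R"
  have step: "coord idx x ((i + l j) mod a) \<le> real (k j + (i + l j) div a) + coord idx x i"
    if "j \<in> {1..m}" "i < a" for i j using R that by blast
  have l: "1 \<le> l j" "l j < a" if "j \<in> {1..m}" for j
    using assms that by fastforce+
  have "x $ idx (l j) \<le> real (k j)" if "j \<in> {1..m}" for j
    using step[OF that assms(1)] l[OF that] by (simp add: coord_def)
  moreover have "x $ idx (i + l j) \<le> real (k j) + x $ idx i"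
    if "j \<in> {1..m}" "i \<in> {1..a-1}" "i + l j < a" for i j
    using step[of j i] l[of j] that by (simp add: coord_def)
  moreover have "x $ idx (i + l j - a) \<le> real (k j) + x $ idx i + 1"
    if "j \<in> {1..m}" "i \<in> {1..a-1}" "i + l j > a" for i j
  proof -
    have "(i + l j) mod a = i + l j - a" "(i + l j) div a = 1"
      using that l[of j] by (auto simp: mod_if div_if)
    moreover have "i < a" using that by auto
    ultimately show ?thesis using step[of j i] that by (simp add: coord_def)
  qed
  moreover have "0 \<le> x $ idx i" if "i \<in> {1..a-1}" for i
  proof -
    have "i < a" "i \<noteq> 0" using that by auto
    with R show ?thesis by (metis coord_def)
  qed
  ultimately show ?L
    unfolding core_inequalities_def by blast
qed

text \<open>Each coordinate is an inner product with a fixed vector, the zero vector for index 0, so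
  the condition is linear.\<close>

lemma polyhedron_coord_le:
  "polyhedron {x. coord idx x s \<le> c + coord idx x t}"
proof -
  define v where "v i = (if i = 0 then 0 else axis (idx i) 1 :: real ^ 'a)" for i :: nat
  have "coord idx x i = v i \<bullet> x" for x i
    by (simp add: coord_def v_def inner_axis')
  then have "{x. coord idx x s \<le> c + coord idx x t} = {x. (v s - v t) \<bullet> x \<le> c}"
    by (auto simp: inner_diff_left)
  then show ?thesis by (simp add: polyhedron_halfspace_le)
qed

lemma polyhedron_core_inequalities:
  assumes "0 < a" "\<forall>j\<in>{1..m}. l j \<in> {1..a-1}"
  shows "polyhedron (core_inequalities idx a m k l)"
proof -
  have "core_inequalities idx a m k l
      = (\<Inter>i<a. {x. coord idx x 0 \<le> 0 + coord idx x i})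
      \<inter> (\<Inter>(j, i)\<in>{1..m} \<times> {..<a}. {x. coord idx x ((i + l j) mod a)
        \<le> real (k j + (i + l j) div a) + coord idx x i})"
    by (auto simp: core_inequalities_iff[OF assms] coord_def[of _ _ 0])
  moreover have "polyhedron \<dots>"
    by (intro polyhedron_Int polyhedron_Inter) (auto intro: polyhedron_coord_le polyhedron_coord_le[where c = 0, simplified])
  ultimately show ?thesis by simp
qed

section \<open>Boundedness from the gcd condition\<close>

text \<open>Since \<open>P\<close> is periodic modulo \<open>a\<close>, subtracting a shift amounts to adding \<open>a - 1\<close> times it, so
  the admissible shifts are closed under the Bezout combinations producing the gcd.\<close>

lemma Gcd_shift_invariant:
  fixes P :: "nat \<Rightarrow> bool"
  assumes "finite A" "0 < a" "\<And>n. P (n + a) \<longleftrightarrow> P n" "\<And>d n. d \<in> A \<Longrightarrow> P n \<Longrightarrow> P (n + d)"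
    and "P n"
  shows "P (n + Gcd A)"
  using assms(1,4,5)
proof (induction A arbitrary: n rule: finite_induct)
  case empty
  then show ?case by simp
next
  case (insert d A)
  have periodic: "P (i + a * q) \<longleftrightarrow> P i" for i q
  proof (induction q)
    case (Suc q)
    then show ?case using assms(3)[of "i + a * q"] by (simp add: algebra_simps)
  qed simp
  have multiple: "P (i + e * q)" if "\<And>i. P i \<Longrightarrow> P (i + e)" "P i" for e i q
  proof (induction q)
    case (Suc q)
    then show ?case using that(1)[of "i + e * q"] by (simp add: algebra_simps)
  qed (use that in simp)
  have shift_d: "P (i + d)" if "P i" for i
    using insert.prems that by blast
  have shift_g: "P (i + Gcd A)" if "P i" for i
    using insert.IH insert.prems(1) that by blast
  show ?case
  proof (cases "d = 0")
    case True
    with shift_g insert.prems show ?thesis by simp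
  next
    case False
    then obtain u v where uv: "d * u = Gcd A * v + gcd d (Gcd A)"
      using bezout_nat by blast
    \<comment> \<open>The factor \<open>a - 1\<close> stands in for subtracting
      \<open>Gcd A * v\<close>: the sum exceeds \<open>n + gcd d (Gcd A)\<close> by a multiple of
      \<open>a\<close>.\<close>
    have "P (n + d * u + Gcd A * (v * (a - 1)))"
      using multiple[of "Gcd A", OF shift_g] multiple[of d, OF shift_d] insert.prems by blast
    also have "n + d * u + Gcd A * (v * (a - 1)) = n + gcd d (Gcd A) + a * (Gcd A * v)"
      using uv assms(2) by (cases a) (auto simp: algebra_simps)
    finally show ?thesis
      using periodic by simp
  qed
qed

lemma bounded_core_inequalities:
  fixes idx :: "nat \<Rightarrow> 'n::finite"
  assumes "0 < a" "Gcd (insert a (b ` {1..m})) = 1"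
    and bkl: "\<forall>j\<in>{1..m}. b j = a * k j + l j \<and> l j \<in> {1..a-1}"
    and idx: "bij_betw idx {1..a-1} (UNIV :: 'n set)"
  shows "bounded (core_inequalities idx a m k l)"
proof -
  let ?S = "core_inequalities idx a m k l"
  have l: "\<forall>j\<in>{1..m}. l j \<in> {1..a-1}" using bkl by blast
  note iff = core_inequalities_iff[OF assms(1) l]
  \<comment> \<open>The bound \<open>C\<close> may depend on \<open>n\<close> but must serve all
    points of \<open>?S\<close> at once.\<close>
  define P where "P n \<longleftrightarrow> (\<exists>C. \<forall>x\<in>?S. coord idx x (n mod a) \<le> C)" for n
  have shift: "P (n + d)" if "d \<in> insert a (b ` {1..m})" "P n" for n d
  proof (cases "d = a")
    case True
    with that show ?thesis by (simp add: P_def)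
  next
    case False
    with that obtain j where j: "j \<in> {1..m}" "d = b j" by blast
    then have "n + d = n + l j + a * k j"
      using bkl by simp
    then have "(n + d) mod a = (n mod a + l j) mod a"
      by (simp only: mod_mult_self2 mod_add_left_eq)
    moreover obtain C where "\<forall>x\<in>?S. coord idx x (n mod a) \<le> C"
      using \<open>P n\<close> P_def by blast
    moreover have "coord idx x ((n mod a + l j) mod a)
        \<le> real (k j + (n mod a + l j) div a) + coord idx x (n mod a)" if "x \<in> ?S" for x
      using that j(1) mod_less_divisor[OF assms(1), of n] unfolding iff by blast
    ultimately show ?thesis
      unfolding P_def by (intro exI[of _ "real (k j + (n mod a + l j) div a) + C"]) fastforce
  qed
  have periodic: "P (n + a) \<longleftrightarrow> P n" for n
    by (simp add: P_def)
  have "P n" for n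
  proof (induction n)
    case 0
    show ?case by (auto simp: P_def coord_def)
  next
    case (Suc n)
    \<comment> \<open>The gcd is 1, so this reaches the successor and thereby every residue.\<close>
    have "P (n + Gcd (insert a (b ` {1..m})))"
      by (rule Gcd_shift_invariant[OF _ assms(1) periodic shift Suc.IH]) simp_all
    with assms(2) show ?case by simp
  qed
  then obtain C where C: "\<And>n x. x \<in> ?S \<Longrightarrow> coord idx x (n mod a) \<le> C n"
    unfolding P_def by metis
  have "norm x \<le> (\<Sum>c\<in>UNIV. C (inv_into {1..a-1} idx c))" if x: "x \<in> ?S" for x
  proof -
    have "\<bar>x $ c\<bar> \<le> C (inv_into {1..a-1} idx c)" for c
    proof -
      define i where "i = inv_into {1..a-1} idx c"
      have "c \<in> idx ` {1..a-1}"
        using bij_betw_imp_surj_on[OF idx] by simp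
      then have "i \<in> {1..a-1}" "idx i = c"
        unfolding i_def by (rule inv_into_into, rule f_inv_into_f)
      then have "coord idx x i = x $ c" "i < a" "i mod a = i"
        by (auto simp: coord_def)
      moreover have "0 \<le> coord idx x i"
        using x iff \<open>i < a\<close> by blast
      ultimately show ?thesis
        using C[OF x, of i] unfolding i_def[symmetric] by simp
    qed
    then show ?thesis
      using norm_le_l1_cart[of x] by (meson order_trans sum_mono)
  qed
  then show ?thesis
    unfolding bounded_iff by blast
qed

section \<open>Integer points as beta sets\<close>

text \<open>The complement of the following set consists of \<open>0\<close> and the numbers \<open>n \<equiv> i (mod a)\<close> with
  \<open>n \<ge> a x\<^sub>i + i\<close>.\<close>

definition below_set :: "(nat \<Rightarrow> 'n::finite) \<Rightarrow> nat \<Rightarrow> real ^ 'n \<Rightarrow> nat set" where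
  "below_set idx a x = {n. real (n div a) < coord idx x (n mod a)}"

text \<open>For natural coordinates, finiteness, \<open>0 \<notin> B\<close> and closure under
  \<open>a\<close> come for free; closure under \<open>b j\<close> is the remaining condition and
  amounts to the inequalities for \<open>j\<close>.\<close>

lemma bij_betw_below_set:
  fixes idx :: "nat \<Rightarrow> 'n::finite"
  assumes a: "0 < a"
    and bkl: "\<forall>j\<in>{1..m}. b j = a * k j + l j \<and> l j \<in> {1..a-1}"
    and idx: "bij_betw idx {1..a-1} (UNIV :: 'n set)"
  shows "bij_betw (below_set idx a) (integer_points (core_inequalities idx a m k l))
    {B. finite B \<and> 0 \<notin> B \<and> (\<forall>z. z \<notin> B \<longrightarrow> z + a \<notin> B)
      \<and> (\<forall>j\<in>{1..m}. \<forall>z. z \<notin> B \<longrightarrow> z + b j \<notin> B)}" (is "bij_betw _ ?I ?T")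
proof -
  let ?g = "below_set idx a"
  have l: "\<forall>j\<in>{1..m}. l j \<in> {1..a-1}" using bkl by blast
  note iff = core_inequalities_iff[OF a l]
  define V where "V = {x :: real ^ 'n. \<forall>c. x $ c \<in> \<nat>}"
  have mem: "a * q + i \<in> ?g x \<longleftrightarrow> real q < coord idx x i" if "i < a" for q i x
    using that by (simp add: below_set_def)
  have coord_idx: "\<exists>i. 0 < i \<and> i < a \<and> idx i = c" for c
  proof -
    obtain i where "i \<in> {1..a-1}" "idx i = c"
      using idx by (metis UNIV_I bij_betw_imp_surj_on imageE)
    then show ?thesis by (intro exI[of _ i]) auto
  qed
  have coord_Nats: "\<exists>q. coord idx x i = real q" if "x \<in> V" for x i
    using that by (auto simp: V_def coord_def elim: Nats_cases)
  have I_sub: "?I \<subseteq> V"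
  proof
    fix x assume x: "x \<in> ?I"
    have "x $ c \<in> \<nat>" for c
    proof -
      obtain i where "0 < i" "i < a" "idx i = c" using coord_idx by blast
      moreover from this x have "0 \<le> coord idx x i" "x $ c \<in> \<int>"
        by (auto simp: integer_points_def iff)
      ultimately show ?thesis by (simp add: coord_def Nats_altdef2)
    qed
    then show "x \<in> V" by (simp add: V_def)
  qed
  \<comment> \<open>If \<open>x\<^sub>i = q\<close>, then \<open>a * q + i\<close> is the least
    nonmember in its class, and testing closure there is enough.\<close>
  have step: "(\<forall>z. z \<notin> ?g x \<longrightarrow> z + b j \<notin> ?g x) \<longleftrightarrow>
      (\<forall>i<a. coord idx x ((i + l j) mod a) \<le> real (k j + (i + l j) div a) + coord idx x i)"
    if x: "x \<in> V" and j: "j \<in> {1..m}" for x j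
  proof -
    \<comment> \<open>The carry of \<open>i + l j\<close> moves into the quotient, so membership can
      be read off in the class of the sum.\<close>
    have split: "a * q + i + b j = a * (q + k j + (i + l j) div a) + (i + l j) mod a" for q i
      using bkl j div_mult_mod_eq[of "i + l j" a] by (simp add: algebra_simps)
    have mem': "a * q + i + b j \<in> ?g x \<longleftrightarrow>
        real (q + k j + (i + l j) div a) < coord idx x ((i + l j) mod a)" for q i
      unfolding split using a by (intro mem) simp
    show ?thesis
    proof (intro iffI allI impI)
      fix i assume closed: "\<forall>z. z \<notin> ?g x \<longrightarrow> z + b j \<notin> ?g x" and i: "i < a"
      obtain q where q: "coord idx x i = real q" using coord_Nats x by blast
      then have "a * q + i + b j \<notin> ?g x" using closed mem[OF i] by simp
      with mem' q show "coord idx x ((i + l j) mod a) \<le> real (k j + (i + l j) div a) + coord idx x i"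
        by simp
    next
      fix z assume le: "\<forall>i<a. coord idx x ((i + l j) mod a)
          \<le> real (k j + (i + l j) div a) + coord idx x i" and z: "z \<notin> ?g x"
      define i q where "i = z mod a" and "q = z div a"
      then have "z = a * q + i" "i < a" using a by auto
      with z le mem mem' show "z + b j \<notin> ?g x" by fastforce
    qed
  qed
  have in_T: "?g x \<in> ?T \<longleftrightarrow> x \<in> ?I" if x: "x \<in> V" for x
  proof -
    have "?g x \<subseteq> (\<Union>i<a. {n. n div a < nat \<lceil>coord idx x i\<rceil>})"
    proof
      fix n assume "n \<in> ?g x"
      then have "real (n div a) < coord idx x (n mod a)"
        by (simp add: below_set_def)
      then have "n div a < nat \<lceil>coord idx x (n mod a)\<rceil>"
        by linarith
      then show "n \<in> (\<Union>i<a. {n. n div a < nat \<lceil>coord idx x i\<rceil>})"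
        using mod_less_divisor[OF a, of n] by blast
    qed
    moreover have "finite {n. n div a < N}" for N
    proof (rule finite_subset)
      show "{n. n div a < N} \<subseteq> {..<N * a}"
        using a by (auto simp: div_less_iff_less_mult)
    qed simp
    ultimately have fin: "finite (?g x)"
      by (auto elim: finite_subset)
    have zero: "0 \<notin> ?g x"
      by (simp add: below_set_def coord_def)
    have closed: "\<forall>z. z \<notin> ?g x \<longrightarrow> z + a \<notin> ?g x"
      using a by (auto simp: below_set_def)
    have nonneg: "\<forall>i<a. 0 \<le> coord idx x i"
      using coord_Nats[OF x] by (metis of_nat_0_le_iff)
    have ints: "\<forall>c. x $ c \<in> \<int>"
      using x Nats_subset_Ints by (auto simp: V_def)
    have "(\<forall>j\<in>{1..m}. \<forall>z. z \<notin> ?g x \<longrightarrow> z + b j \<notin> ?g x) \<longleftrightarrow>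
        (\<forall>j\<in>{1..m}. \<forall>i<a. coord idx x ((i + l j) mod a)
          \<le> real (k j + (i + l j) div a) + coord idx x i)"
      by (intro ball_cong refl step x)
    with fin zero closed nonneg ints show ?thesis
      unfolding integer_points_def mem_Collect_eq iff by argo
  qed
  show ?thesis
  proof (rule bij_betw_imageI)
    show "inj_on ?g ?I"
    proof (rule inj_onI)
      fix x y assume xy: "x \<in> ?I" "y \<in> ?I" and eq: "?g x = ?g y"
      have "x $ c = y $ c" for c
      proof -
        obtain i where i: "0 < i" "i < a" "idx i = c" using coord_idx by blast
        obtain q r where qr: "coord idx x i = real q" "coord idx y i = real r"
          using coord_Nats xy I_sub by (meson subsetD)
        \<comment> \<open>The members of class \<open>i\<close> are those with quotient below
          \<open>x\<^sub>i\<close>, so the set determines the coordinate.\<close>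
        have "s < q \<longleftrightarrow> s < r" for s
          using mem[OF i(2), of s x] mem[OF i(2), of s y] eq qr by simp
        then have "q = r" by (metis less_irrefl nat_neq_iff)
        with qr i show ?thesis by (simp add: coord_def)
      qed
      then show "x = y" by (simp add: vec_eq_iff)
    qed
    show "?g ` ?I = ?T"
    proof (intro equalityI subsetI)
      fix B assume "B \<in> ?g ` ?I"
      then obtain x where x: "x \<in> ?I" "B = ?g x" by blast
      with I_sub have "x \<in> V" by blast
      then show "B \<in> ?T"
        unfolding x(2) by (rule iffD2[OF in_T x(1)])
    next
      fix B assume B: "B \<in> ?T"
      then have fin: "finite B" and zero: "0 \<notin> B" and closed: "\<forall>z. z \<notin> B \<longrightarrow> z + a \<notin> B"
        unfolding mem_Collect_eq by - (elim conjE, assumption)+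
      \<comment> \<open>The first missing quotient in each class; it exists because \<open>B\<close>
        is finite.\<close>
      define h where "h i = (LEAST q. a * q + i \<notin> B)" for i
      define x :: "real ^ 'n" where "x = (\<chi> c. real (h (inv_into {1..a-1} idx c)))"
      \<comment> \<open>This agrees with the value 0 that \<open>coord\<close> assigns to index
        0.\<close>
      have "h 0 = 0"
        using zero by (simp add: h_def Least_eq_0)
      then have coord: "coord idx x i = real (h i)" if "i < a" for i
        using that idx
        by (auto simp: coord_def x_def bij_betw_def inv_into_f_f)
      have h: "q < h i \<longleftrightarrow> a * q + i \<in> B" for i q
      proof -
        obtain N where N: "\<forall>n\<in>B. n < N"
          using fin finite_nat_set_iff_bounded by blast
        have "N \<le> a * N + i" using a by (cases a) auto
        with N have ex: "a * N + i \<notin> B" by force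
        have least: "a * h i + i \<notin> B"
          unfolding h_def by (rule LeastI[of _ N]) (rule ex)
        \<comment> \<open>Closure under \<open>a\<close> keeps everything above the first missing
          element missing, so \<open>h\<close> describes the whole class.\<close>
        have "a * (h i + d) + i \<notin> B" for d
        proof (induction d)
          case (Suc d)
          then have "a * (h i + d) + i + a \<notin> B" using closed by blast
          then show ?case by (simp add: algebra_simps)
        qed (use least in simp)
        then have "a * q + i \<notin> B" if "h i \<le> q"
          using that by (metis le_add_diff_inverse)
        moreover have "a * q + i \<in> B" if "q < h i"
          using that not_less_Least unfolding h_def by blast
        ultimately show ?thesis by (meson not_le)
      qed
      have eq: "?g x = B"
      proof (rule set_eqI)
        fix n
        have "n \<in> ?g x \<longleftrightarrow> n div a < h (n mod a)"
          using coord[of "n mod a"] a by (simp add: below_set_def)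
        then show "n \<in> ?g x \<longleftrightarrow> n \<in> B"
          using h[of "n div a" "n mod a"] by simp
      qed
      have "x \<in> V"
        by (simp add: V_def x_def)
      then have "x \<in> ?I"
        by (rule iffD1[OF in_T]) (unfold eq, rule B)
      with eq show "B \<in> ?g ` ?I" by blast
    qed
  qed
qed

theorem proposition4p1:
  fixes a m :: nat and b k l :: "nat \<Rightarrow> nat" and idx :: "nat \<Rightarrow> 'n::finite"
  assumes "1 \<le> m"
    and "0 < a" and "\<forall>j\<in>{1..m}. 0 < b j"
    and "Gcd (insert a (b ` {1..m})) = 1"
    and "\<forall>j\<in>{1..m}. b j = a * k j + l j \<and> l j \<in> {1..a-1}"
    and "bij_betw idx {1..a-1} (UNIV :: 'n set)"
  shows "polytope (core_inequalities idx a m k l)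
    \<and> bounded (core_inequalities idx a m k l)
    \<and> (\<exists>f. bij_betw f (simultaneous_cores a m b)
                       (integer_points (core_inequalities idx a m k l)))"
proof (intro conjI)
  show bounded: "bounded (core_inequalities idx a m k l)"
    using assms(2,4,5,6) by (rule bounded_core_inequalities)
  with polyhedron_core_inequalities[of a m l idx k] assms(2,5)
  show "polytope (core_inequalities idx a m k l)"
    by (simp add: polytope_eq_bounded_polyhedron)
  show "\<exists>f. bij_betw f (simultaneous_cores a m b)
      (integer_points (core_inequalities idx a m k l))"
    \<comment> \<open>Both bijections end in the same family of sets, so the second is
      inverted.\<close>
    using bij_betw_trans[OF bij_betw_beta_set[OF assms(2,3)]
        bij_betw_inv_into[OF bij_betw_below_set[OF assms(2,5,6)]]] by blast
qed

end
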